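(* Let $(b_n)_{n\ge1}$ be an increasing sequence of positive reals such that $\lim_nb_n=\infty$. In the one-sided unbounded forecasting game, Skeptic can weakly force the event $S_n/b_n\to0$ if and only if $\sum_n1/b_n<\infty$.
   Context: "Increasing" means nondecreasing. One-sided unbounded forecasting game (OUFG). Skeptic starts with an initial capital $\mathcal K_0>0$. On each round $n=1,2,\dots$, Skeptic announces $M_n\in\mathbb R$, then Reality announces $x_n\in[-1,\infty)$, and $\mathcal K_n=\mathcal K_{n-1}+M_nx_n$. Skeptic must keep $\mathcal K_n\ge 0$ for all $n$ whatever Reality does. A path is an infinite sequence $(x_n)_{n\ge1}$ in $[-1,\infty)$; an event is a set of paths. Skeptic can weakly force an event $E$ if he has a strategy ($M_n$ as a function of $x_1,\dots,x_{n-1}$, keeping the capital nonnegative on every path) such that $\limsup_n\mathcal K_n=\infty$ on every path not in $E$. Notation: $S_n=x_1+\dots+x_n$. *)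

theory Defs
  imports Complex_Main "HOL-Library.Extended_Real"
begin

(* Sequences are indexed by n >= 1, as in x_1, x_2, ...; the value of a function
   nat => real at 0 is never used. *)

definition oufg_path :: "(nat \<Rightarrow> real) set" where
  "oufg_path = {x. \<forall>n\<ge>1. - 1 \<le> x n}"

(* A strategy maps the list [x_1, ..., x_{n-1}] of Reality's past moves to M_n. *)
type_synonym strategy = "real list \<Rightarrow> real"

primrec capital :: "real \<Rightarrow> strategy \<Rightarrow> (nat \<Rightarrow> real) \<Rightarrow> nat \<Rightarrow> real" where
  "capital K0 M x 0 = K0"
| "capital K0 M x (Suc n) = capital K0 M x n + M (map x [1..<Suc n]) * x (Suc n)"

definition admissible :: "real \<Rightarrow> strategy \<Rightarrow> bool" where
  "admissible K0 M \<longleftrightarrow> (\<forall>x\<in>oufg_path. \<forall>n. 0 \<le> capital K0 M x n)"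

definition can_weakly_force :: "real \<Rightarrow> (nat \<Rightarrow> real) set \<Rightarrow> bool" where
  "can_weakly_force K0 E \<longleftrightarrow>
     (\<exists>M. admissible K0 M \<and>
          (\<forall>x \<in> oufg_path - E. limsup (\<lambda>n. ereal (capital K0 M x n)) = \<infinity>))"

definition partial_sum :: "(nat \<Rightarrow> real) \<Rightarrow> nat \<Rightarrow> real" where
  "partial_sum x n = (\<Sum>k=1..n. x k)"

end

theory Submission
  imports Defs "HOL-Analysis.Infinite_Products"
begin

text \<open>
  If the series converges, Skeptic bets a fixed multiple of \<open>1 / b\<^sub>n\<close>. Since \<open>x\<^sub>n \<ge> - 1\<close>, the
  negative part of \<open>\<Sum> x\<^sub>n / b\<^sub>n\<close> converges, so a bounded capital makes this series converge
  absolutely, and Kronecker's lemma applies.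

  If Skeptic can weakly force the event, let Reality only use the moves \<open>-1\<close> and \<open>b\<^sub>n\<close>, and let an
  imaginary second gambler with capital \<open>L\<close> bet \<open>- L / (2 b\<^sub>n)\<close>: he survives, and he gets rich if
  the move \<open>b\<^sub>n\<close> occurs only finitely often while \<open>\<Sum> 1 / b\<^sub>n = \<infinity>\<close>. By choosing the sign of
  \<open>x\<^sub>n\<close> against the total bet, Reality keeps the sum of both capitals bounded. Skeptic's capital is
  then bounded, so \<open>S\<^sub>n / b\<^sub>n \<rightarrow> 0\<close>; hence \<open>x\<^sub>n = b\<^sub>n\<close> only finitely often, and boundedness of \<open>L\<close>
  gives convergence of \<open>\<Sum> 1 / b\<^sub>n\<close>.
\<close>

lemma partial_sum_lessThan: "partial_sum x n = (\<Sum>k<n. x (Suc k))"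
  unfolding partial_sum_def by (simp add: sum.atLeast1_atMost_eq)

text \<open>Absolute convergence reduces this case of Kronecker's lemma to dominated convergence for
  series (Tannery): for fixed \<open>k\<close> the term \<open>x (Suc k) / b n\<close> vanishes as
  \<open>n\<close> grows, and monotonicity of \<open>b\<close> yields a summable bound independent
  of \<open>n\<close>.\<close>

lemma kronecker_absolute:
  fixes b x :: "nat \<Rightarrow> real"
  assumes b_pos: "\<And>n. 1 \<le> n \<Longrightarrow> 0 < b n"
    and b_mono: "mono_on {1..} b"
    and b_lim: "filterlim b at_top sequentially"
    and sm: "summable (\<lambda>k. \<bar>x (Suc k) / b (Suc k)\<bar>)"
  shows "(\<lambda>n. partial_sum x n / b n) \<longlonglongrightarrow> 0"
proof -
  \<comment> \<open>Padding with zeros turns the finite sums, whose range varies with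
    \<open>n\<close>, into series over all \<open>k\<close>.\<close>
  define a where "a k n = (if k < n then x (Suc k) / b n else 0)" for k n
  have lim: "(\<lambda>n. a k n) \<longlonglongrightarrow> 0" for k
  proof (rule Lim_null_comparison)
    show "\<forall>\<^sub>F n in sequentially. norm (a k n) \<le> norm (x (Suc k) / b n)"
      by (simp add: a_def)
    show "(\<lambda>n. norm (x (Suc k) / b n)) \<longlonglongrightarrow> 0"
      by (intro tendsto_norm_zero real_tendsto_divide_at_top[OF tendsto_const b_lim])
  qed
  have bd: "norm (a k n) \<le> \<bar>x (Suc k) / b (Suc k)\<bar>" for k n
  proof (cases "k < n")
    case True
    then have "b (Suc k) \<le> b n"
      using mono_onD[OF b_mono, of "Suc k" n] by simp
    moreover have "0 < b (Suc k)" using b_pos by simp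
    ultimately show ?thesis
      using True by (simp add: a_def frac_le)
  qed (simp add: a_def)
  have "\<forall>\<^sub>F (k, n) in sequentially \<times>\<^sub>F sequentially. norm (a k n) \<le> \<bar>x (Suc k) / b (Suc k)\<bar>"
    using bd by (intro always_eventually) auto
  then have "(\<lambda>n. \<Sum>k. a k n) \<longlonglongrightarrow> (\<Sum>k. 0)"
    using tannerys_theorem[of a "\<lambda>_. 0" sequentially, OF lim _ sm] by simp
  moreover have "(\<Sum>k. a k n) = partial_sum x n / b n" for n
  proof -
    have "(\<Sum>k. a k n) = (\<Sum>k<n. a k n)"
      by (rule suminf_finite) (auto simp: a_def)
    then show ?thesis
      by (simp add: partial_sum_lessThan sum_divide_distrib a_def)
  qed
  ultimately show ?thesis by simp
qed

lemma capital_deterministic_bets: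
  "capital K0 (\<lambda>xs. c (Suc (length xs))) x n = K0 + (\<Sum>k<n. c (Suc k) * x (Suc k))"
  by (induction n) (simp_all del: upt_Suc add: algebra_simps)

lemma weakly_force_if_summable:
  fixes b :: "nat \<Rightarrow> real" and K0 :: real
  assumes K0_pos: "0 < K0"
    and b_pos: "\<And>n. 1 \<le> n \<Longrightarrow> 0 < b n"
    and b_mono: "mono_on {1..} b"
    and b_lim: "filterlim b at_top sequentially"
    and sm: "summable (\<lambda>n. 1 / b (Suc n))"
  shows "can_weakly_force K0 {x \<in> oufg_path. (\<lambda>n. partial_sum x n / b n) \<longlonglongrightarrow> 0}"
proof -
  define C where "C = (\<Sum>n. 1 / b (Suc n))"
  \<comment> \<open>The worst case is that every move is \<open>- 1\<close>; the total loss is then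
    at most \<open>c * C = K0\<close>.\<close>
  define c where "c = K0 / C"
  define M where "M = (\<lambda>xs :: real list. c / b (Suc (length xs)))"
  have bS: "0 < b (Suc n)" for n using b_pos by simp
  have C_pos: "0 < C"
    unfolding C_def using bS by (intro suminf_pos sm) simp
  have c_pos: "0 < c" using K0_pos C_pos by (simp add: c_def)
  have sum_le: "(\<Sum>k<n. 1 / b (Suc k)) \<le> C" for n
    unfolding C_def using bS by (intro sum_le_suminf sm) (auto simp: less_imp_le)
  have cap: "capital K0 M x n = K0 + c * (\<Sum>k<n. x (Suc k) / b (Suc k))" for x n
    using capital_deterministic_bets[of K0 "\<lambda>n. c / b n" x n]
    by (simp add: M_def sum_distrib_left)
  have "0 \<le> capital K0 M x n" if x: "x \<in> oufg_path" for x n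
  proof -
    have "(\<Sum>k<n. - (1 / b (Suc k))) \<le> (\<Sum>k<n. x (Suc k) / b (Suc k))"
    proof (rule sum_mono)
      fix k
      have "- 1 \<le> x (Suc k)" using x by (simp add: oufg_path_def)
      then show "- (1 / b (Suc k)) \<le> x (Suc k) / b (Suc k)"
        using divide_right_mono[of "- 1" "x (Suc k)" "b (Suc k)"] bS[of k] by simp
    qed
    then have "- C \<le> (\<Sum>k<n. x (Suc k) / b (Suc k))"
      using sum_le[of n] by (simp add: sum_negf)
    then have "c * - C \<le> c * (\<Sum>k<n. x (Suc k) / b (Suc k))"
      using c_pos by (intro mult_left_mono) auto
    then show ?thesis using C_pos by (simp add: cap c_def)
  qed
  then have "admissible K0 M" by (simp add: admissible_def)
  moreover have "(\<lambda>n. partial_sum x n / b n) \<longlonglongrightarrow> 0"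
    if x: "x \<in> oufg_path" and fin: "limsup (\<lambda>n. ereal (capital K0 M x n)) \<noteq> \<infinity>" for x
  proof -
    obtain B where B: "\<And>n. capital K0 M x n \<le> B"
      using limsup_finite_then_bounded[of "capital K0 M x"] fin by auto
    \<comment> \<open>Adding 1 to each move makes the terms nonnegative, so bounded partial sums
      suffice for convergence; the added series \<open>1 / b (Suc k)\<close> is summable.\<close>
    define y where "y = (\<lambda>k. (x (Suc k) + 1) / b (Suc k))"
    have y_nonneg: "0 \<le> y k" for k
    proof -
      have "- 1 \<le> x (Suc k)" using x by (simp add: oufg_path_def)
      then show ?thesis using bS[of k] by (simp add: y_def)
    qed
    have "(\<Sum>k<n. y k) \<le> (B - K0) / c + C" for n
    proof -
      have "c * (\<Sum>k<n. x (Suc k) / b (Suc k)) \<le> B - K0"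
        using B[of n] by (simp add: cap)
      then have "(\<Sum>k<n. x (Suc k) / b (Suc k)) \<le> (B - K0) / c"
        using c_pos by (simp add: field_simps)
      then show ?thesis
        using sum_le[of n] by (simp add: y_def add_divide_distrib sum.distrib)
    qed
    with y_nonneg have "summable y" by (rule summableI_nonneg_bounded)
    then have "summable (\<lambda>k. y k + 1 / b (Suc k))" using sm by (rule summable_add)
    then have "summable (\<lambda>k. \<bar>x (Suc k) / b (Suc k)\<bar>)"
    proof (rule summable_comparison_test'[where N = 0])
      fix k
      have "x (Suc k) / b (Suc k) = y k - 1 / b (Suc k)"
        by (simp add: y_def add_divide_distrib)
      moreover have "0 \<le> 1 / b (Suc k)" using bS[of k] by simp
      ultimately show "norm \<bar>x (Suc k) / b (Suc k)\<bar> \<le> y k + 1 / b (Suc k)"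
        using y_nonneg[of k] unfolding real_norm_def by linarith
    qed
    with b_pos b_mono b_lim show ?thesis by (rule kronecker_absolute)
  qed
  ultimately show ?thesis
    unfolding can_weakly_force_def by blast
qed

text \<open>The histories are built first, by appending the reply of \<open>r\<close> to the current
  one; the path reads off their last entries. The arbitrary value \<open>x 0 = last []\<close> never
  enters a history.\<close>

lemma exists_path_following:
  fixes r :: "real list \<Rightarrow> real"
  shows "\<exists>x. \<forall>n. x (Suc n) = r (map x [1..<Suc n])"
proof -
  define h where "h = rec_nat [] (\<lambda>_ xs. xs @ [r xs])"
  define x where "x n = last (h n)" for n
  have "map x [1..<Suc n] = h n" for n
    by (induction n) (simp_all add: h_def x_def)
  then have "x (Suc n) = r (map x [1..<Suc n])" for n
    by (simp add: x_def h_def)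
  then show ?thesis by blast
qed

lemma summable_if_weakly_force:
  fixes b :: "nat \<Rightarrow> real" and K0 :: real
  assumes b_pos: "\<And>n. 1 \<le> n \<Longrightarrow> 0 < b n"
    and b_mono: "mono_on {1..} b"
    and force: "can_weakly_force K0 {x \<in> oufg_path. (\<lambda>n. partial_sum x n / b n) \<longlonglongrightarrow> 0}"
  shows "summable (\<lambda>n. 1 / b (Suc n))"
proof -
  have bS: "0 < b (Suc n)" for n using b_pos by simp
  obtain M where adm: "admissible K0 M"
    and M: "\<And>x. x \<in> oufg_path \<Longrightarrow> limsup (\<lambda>n. ereal (capital K0 M x n)) \<noteq> \<infinity>
              \<Longrightarrow> (\<lambda>n. partial_sum x n / b n) \<longlonglongrightarrow> 0"
    using force unfolding can_weakly_force_def by blast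
  \<comment> \<open>Capital of the imaginary gambler, starting from 1, as a function of the history,
    so that Reality's rule \<open>r\<close> can consult it.\<close>
  define Lh where
    "Lh xs = (\<Prod>i<length xs. 1 - xs ! i / (2 * b (Suc i)))" for xs :: "real list"
  define r where
    "r xs = (let \<beta> = b (Suc (length xs)) in if Lh xs / (2 * \<beta>) \<le> M xs then - 1 else \<beta>)" for xs
  obtain x where x: "\<And>n. x (Suc n) = r (map x [1..<Suc n])"
    using exists_path_following[of r] by blast
  define L where "L n = (\<Prod>i<n. 1 - x (Suc i) / (2 * b (Suc i)))" for n
  define K where "K = capital K0 M x"
  have Lh: "Lh (map x [1..<Suc n]) = L n" for n
    unfolding Lh_def L_def by (rule prod.cong) (simp_all del: upt_Suc)
  have step: "x (Suc n) =
      (if L n / (2 * b (Suc n)) \<le> M (map x [1..<Suc n]) then - 1 else b (Suc n))" for n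
    unfolding x r_def Let_def Lh by (simp del: upt_Suc)
  have path: "x \<in> oufg_path"
    unfolding oufg_path_def
  proof safe
    fix n :: nat
    assume "1 \<le> n"
    then obtain m where "n = Suc m" by (cases n) auto
    then show "- 1 \<le> x n" using step[of m] bS[of m] by (auto split: if_splits)
  qed
  have L_pos: "0 < L n" for n
    unfolding L_def
  proof (rule prod_pos)
    fix i
    \<comment> \<open>The factor is \<open>1 / 2\<close> after the move \<open>b (Suc i)\<close> and
      exceeds 1 after \<open>- 1\<close>.\<close>
    show "0 < 1 - x (Suc i) / (2 * b (Suc i))"
      using step[of i] bS[of i] by (auto simp: field_simps split: if_splits)
  qed
  have total: "K n + L n \<le> K0 + 1" for n
  proof (induction n)
    case 0
    then show ?case by (simp add: K_def L_def)
  next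
    case (Suc n)
    define m where "m = M (map x [1..<Suc n])"
    \<comment> \<open>The bracket is the joint bet of both gamblers; \<open>r\<close> gives the move
      the opposite sign.\<close>
    have "(m - L n / (2 * b (Suc n))) * x (Suc n) \<le> 0"
      using step[of n] bS[of n] by (auto simp: m_def mult_le_0_iff split: if_splits)
    moreover have "K (Suc n) + L (Suc n) = K n + L n + (m - L n / (2 * b (Suc n))) * x (Suc n)"
      by (simp add: K_def L_def m_def algebra_simps del: upt_Suc)
    ultimately show ?case using Suc by linarith
  qed
  have K_nonneg: "0 \<le> K n" for n
    using adm path by (simp add: admissible_def K_def)
  have "limsup (\<lambda>n. ereal (K n)) \<le> ereal (K0 + 1)"
  proof (rule Limsup_bounded, rule always_eventually, rule allI)
    fix n
    show "ereal (K n) \<le> ereal (K0 + 1)" using total[of n] L_pos[of n] by simp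
  qed
  then have "limsup (\<lambda>n. ereal (K n)) \<noteq> \<infinity>" by auto
  then have S: "(\<lambda>n. partial_sum x n / b n) \<longlonglongrightarrow> 0"
    using M path by (simp add: K_def)
  \<comment> \<open>With the common denominator \<open>b (Suc n)\<close>, consecutive partial sums
    differ by \<open>x (Suc n) / b (Suc n)\<close>.\<close>
  have "(\<lambda>n. partial_sum x n / b (Suc n)) \<longlonglongrightarrow> 0"
  proof (rule Lim_null_comparison)
    show "(\<lambda>n. norm (partial_sum x n / b n)) \<longlonglongrightarrow> 0" using S by (rule tendsto_norm_zero)
    have "norm (partial_sum x n / b (Suc n)) \<le> norm (partial_sum x n / b n)" if "1 \<le> n" for n
    proof -
      have "b n \<le> b (Suc n)" using mono_onD[OF b_mono, of n "Suc n"] that by simp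
      then show ?thesis
        using b_pos[OF that] bS[of n] by (simp add: frac_le)
    qed
    then show "\<forall>\<^sub>F n in sequentially. norm (partial_sum x n / b (Suc n)) \<le> norm (partial_sum x n / b n)"
      by (rule eventually_sequentiallyI)
  qed
  then have "(\<lambda>n. partial_sum x (Suc n) / b (Suc n) - partial_sum x n / b (Suc n)) \<longlonglongrightarrow> 0 - 0"
    using LIMSEQ_Suc[OF S] by (intro tendsto_diff)
  then have "(\<lambda>n. x (Suc n) / b (Suc n)) \<longlonglongrightarrow> 0"
    by (simp add: partial_sum_def add_divide_distrib)
  \<comment> \<open>The move \<open>b (Suc n)\<close> would make this ratio exactly 1, so only
    \<open>- 1\<close> remains from some round on.\<close>
  then have "\<forall>\<^sub>F n in sequentially. x (Suc n) / b (Suc n) < 1"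
    by (rule order_tendstoD) simp
  then obtain N where N: "\<And>n. N \<le> n \<Longrightarrow> x (Suc n) / b (Suc n) < 1"
    by (auto simp: eventually_sequentially)
  have down: "x (Suc n) = - 1" if "N \<le> n" for n
    using N[OF that] step[of n] bS[of n] by (auto split: if_splits)
  define f where "f i = 1 / (2 * b (Suc (i + N)))" for i
  have f_nonneg: "0 \<le> f i" for i using bS by (simp add: f_def less_imp_le)
  have L_shift: "L (n + N) = L N * (\<Prod>i<n. 1 + f i)" for n
    by (induction n) (simp_all add: L_def f_def down)
  \<comment> \<open>From round \<open>N\<close> on, \<open>L\<close> grows by the factors
    \<open>1 + f i\<close>; their product dominates the sum of the \<open>f i\<close>, while
    \<open>L\<close> stays below \<open>K0 + 1\<close>.\<close>
  have "(\<Sum>i<n. f i) \<le> (K0 + 1) / L N" for n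
  proof -
    have "(\<Sum>i<n. f i) \<le> (\<Prod>i<n. 1 + f i)" using f_nonneg by (rule sum_le_prod)
    also have "\<dots> = L (n + N) / L N" using L_pos[of N] by (simp add: L_shift)
    also have "\<dots> \<le> (K0 + 1) / L N"
      using total[of "n + N"] K_nonneg[of "n + N"] L_pos[of N] by (intro divide_right_mono) auto
    finally show ?thesis .
  qed
  with f_nonneg have "summable f" by (rule summableI_nonneg_bounded)
  then have "summable (\<lambda>i. 2 * f i)" by (rule summable_mult)
  moreover have "2 * f i = 1 / b (Suc (i + N))" for i by (simp add: f_def)
  ultimately have "summable (\<lambda>i. 1 / b (Suc (i + N)))" by simp
  then show ?thesis using summable_iff_shift[of "\<lambda>n. 1 / b (Suc n)" N] by blast
qed

theorem proposition6p1:
  fixes b :: "nat \<Rightarrow> real" and K0 :: real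
  assumes K0_pos: "0 < K0"
    and b_pos: "\<And>n. 1 \<le> n \<Longrightarrow> 0 < b n"
    and b_increasing: "mono_on {1..} b"
    and b_unbounded: "filterlim b at_top sequentially"
  shows "can_weakly_force K0 {x \<in> oufg_path. (\<lambda>n. partial_sum x n / b n) \<longlonglongrightarrow> 0}
    \<longleftrightarrow> summable (\<lambda>n. 1 / b (Suc n))"
proof
  assume "can_weakly_force K0 {x \<in> oufg_path. (\<lambda>n. partial_sum x n / b n) \<longlonglongrightarrow> 0}"
  with b_pos b_increasing show "summable (\<lambda>n. 1 / b (Suc n))"
    by (rule summable_if_weakly_force)
next
  assume "summable (\<lambda>n. 1 / b (Suc n))"
  with K0_pos b_pos b_increasing b_unbounded
  show "can_weakly_force K0 {x \<in> oufg_path. (\<lambda>n. partial_sum x n / b n) \<longlonglongrightarrow> 0}"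
    by (rule weakly_force_if_summable)
qed

end
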